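(* If $1\le p<q<\infty$, then the inclusion $\ell_p^{\lambda}(\widehat F)\subset\ell_q^{\lambda}(\widehat F)$ holds and is strict.
   Context: $\mathbb N_0=\{0,1,2,\dots\}$; $\omega$ is the space of all real sequences $x=(x_k)_{k\in\mathbb N_0}$. Fibonacci numbers: $f_0=f_1=1$, $f_n=f_{n-1}+f_{n-2}$ for $n\ge 2$. $\lambda=(\lambda_k)_{k\in\mathbb N_0}$ is a fixed strictly increasing sequence of positive reals with $\lambda_k\to\infty$. Terms with negative subscript are $0$ (so $\lambda_{-1}=0$, $x_{-1}=0$). For $x\in\omega$ put $$E_n(x)=\frac1{\lambda_n}\sum_{k=0}^n(\lambda_k-\lambda_{k-1})\Big(\frac{f_k}{f_{k+1}}x_k-\frac{f_{k+1}}{f_k}x_{k-1}\Big),\qquad Ex=(E_n(x))_{n\in\mathbb N_0}.$$ For $1\le r<\infty$, $\ell_r^{\lambda}(\widehat F)=\{x\in\omega: Ex\in\ell_r\}$. Here $q$ is just a real number larger than $p$ (not the conjugate exponent). *)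

theory Defs
  imports "HOL-Analysis.Analysis" "HOL-Number_Theory.Fib"
begin

(* The library's fib starts 0, 1, 1, 2, ...; the Fibonacci numbers used here start
   f_0 = f_1 = 1, hence the shift by one. *)
definition fibo :: "nat \<Rightarrow> real" where
  "fibo n = real (fib (Suc n))"

(* prev x k is x_{k-1}, with the convention that terms with negative subscript are 0. *)
definition prev :: "(nat \<Rightarrow> real) \<Rightarrow> nat \<Rightarrow> real" where
  "prev x k = (if k = 0 then 0 else x (k - 1))"

definition E :: "(nat \<Rightarrow> real) \<Rightarrow> (nat \<Rightarrow> real) \<Rightarrow> nat \<Rightarrow> real" where
  "E lam x n = 1 / lam n *
     (\<Sum>k\<le>n. (lam k - prev lam k) *
        (fibo k / fibo (k + 1) * x k - fibo (k + 1) / fibo k * prev x k))"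

definition ell :: "real \<Rightarrow> (nat \<Rightarrow> real) set" where
  "ell r = {x. summable (\<lambda>k. \<bar>x k\<bar> powr r)}"

definition ell_lambda_F :: "real \<Rightarrow> (nat \<Rightarrow> real) \<Rightarrow> (nat \<Rightarrow> real) set" where
  "ell_lambda_F r lam = {x. E lam x \<in> ell r}"

end

theory Submission
  imports Defs
begin

text \<open>
  The inclusion is the usual monotonicity of the sequence spaces \<open>\<ell>\<^sub>r\<close> in \<open>r\<close>, applied to \<open>Ex\<close>.
  It is strict because \<open>E\<close> is triangular with nonzero diagonal, hence maps onto all sequences:
  any preimage of \<open>(n + 1) powr (- 1 / p)\<close> separates the two spaces.
\<close>

text \<open>Terms of a convergent series tend to 0, so eventually
  \<open>\<bar>x k\<bar> \<le> 1\<close>, and there the larger exponent gives the smaller power;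
  comparison of the tails suffices.\<close>

lemma ell_mono:
  assumes "0 < p" "p \<le> q"
  shows "ell p \<subseteq> ell q"
proof
  fix x assume "x \<in> ell p"
  then have s: "summable (\<lambda>k. \<bar>x k\<bar> powr p)"
    by (simp add: ell_def)
  then have "(\<lambda>k. \<bar>x k\<bar> powr p) \<longlonglongrightarrow> 0"
    by (rule summable_LIMSEQ_zero)
  then have ev: "eventually (\<lambda>k. \<bar>x k\<bar> powr p < 1) sequentially"
    by (rule order_tendstoD) simp
  have "eventually (\<lambda>k. norm (\<bar>x k\<bar> powr q) \<le> \<bar>x k\<bar> powr p) sequentially"
    using ev
  proof eventually_elim
    case (elim k)
    have "\<bar>x k\<bar> \<le> 1"
    proof (rule ccontr)
      assume "\<not> \<bar>x k\<bar> \<le> 1"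
      then have "1 \<le> \<bar>x k\<bar> powr p"
        using assms by (intro ge_one_powr_ge_zero) auto
      with elim show False by simp
    qed
    then show ?case
      using assms by (cases "x k = 0") (auto intro: powr_mono')
  qed
  then have "summable (\<lambda>k. \<bar>x k\<bar> powr q)"
    using s by (rule summable_comparison_test_ev)
  then show "x \<in> ell q"
    by (simp add: ell_def)
qed

text \<open>An index shift reduces this to the p-series criterion. For \<open>s = - 1 / p\<close>
  with \<open>p > 0\<close> the condition becomes \<open>r > p\<close>.\<close>

lemma powr_mem_ell_iff:
  "(\<lambda>n. real (Suc n) powr s) \<in> ell r \<longleftrightarrow> s * r < - 1"
proof -
  have "(\<lambda>n. real (Suc n) powr s) \<in> ell r \<longleftrightarrow> summable (\<lambda>n. real (Suc n) powr (s * r))"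
    by (simp add: ell_def powr_powr)
  also have "\<dots> \<longleftrightarrow> summable (\<lambda>n. real n powr (s * r))"
    by (subst summable_Suc_iff) simp
  finally show ?thesis
    by (simp add: summable_real_powr_iff)
qed

lemma fibo_pos: "0 < fibo n"
  by (simp add: fibo_def fib_neq_0_nat)

lemma sum_diff_prev: "(\<Sum>k\<le>n. a k - prev a k) = a n"
  by (induction n) (auto simp: prev_def)

text \<open>Forward substitution: the recursion solves the bracket in \<open>E\<close>, set equal to
  \<open>z k\<close>, for \<open>x k\<close> in terms of the preceding entry.\<close>

primrec E_preimage :: "(nat \<Rightarrow> real) \<Rightarrow> nat \<Rightarrow> real" where
  "E_preimage z 0 = fibo 1 / fibo 0 * z 0"
| "E_preimage z (Suc k) = fibo (k + 2) / fibo (k + 1) *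
     (z (Suc k) + fibo (k + 2) / fibo (k + 1) * E_preimage z k)"

lemma E_preimage_difference:
  "fibo k / fibo (k + 1) * E_preimage z k - fibo (k + 1) / fibo k * prev (E_preimage z) k = z k"
proof -
  have "fibo k \<noteq> 0" "fibo (k + 1) \<noteq> 0"
    using fibo_pos by (metis less_irrefl)+
  then show ?thesis
    by (cases k) (simp_all add: prev_def)
qed

lemma surj_E:
  assumes "strict_mono lam" "\<And>k. lam k > 0"
  shows "surj (E lam)"
proof -
  have "\<exists>x. y = E lam x" for y :: "nat \<Rightarrow> real"
  proof -
    \<comment> \<open>\<open>E lam x = y\<close> requires the weighted sum up to \<open>n\<close> to
      be \<open>s n\<close>. Its increments, divided by the weights, prescribe the brackets
      \<open>z k\<close>.\<close>
    define s where "s n = lam n * y n" for n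
    define z where "z k = (s k - prev s k) / (lam k - prev lam k)" for k
    \<comment> \<open>At \<open>k = 0\<close> the weight is \<open>lam 0\<close>, so positivity is
      used there and strict monotonicity at all later indices.\<close>
    have "lam k - prev lam k > 0" for k
      using assms by (auto simp: prev_def strict_mono_less)
    then have nz: "lam k - prev lam k \<noteq> 0" for k
      by (metis less_irrefl)
    have "E lam (E_preimage z) n = y n" for n
    proof -
      have "E lam (E_preimage z) n = 1 / lam n * (\<Sum>k\<le>n. (lam k - prev lam k) * z k)"
        by (simp only: E_def E_preimage_difference)
      also have "(\<Sum>k\<le>n. (lam k - prev lam k) * z k) = (\<Sum>k\<le>n. s k - prev s k)"
        using nz by (simp add: z_def)
      also have "1 / lam n * \<dots> = y n"
        using assms(2)[of n] unfolding sum_diff_prev by (simp add: s_def)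
      finally show ?thesis .
    qed
    then show ?thesis by (metis ext)
  qed
  then show ?thesis by (simp add: surj_def)
qed

theorem theorem2p6:
  fixes lam :: "nat \<Rightarrow> real" and p q :: real
  assumes "strict_mono lam"
    and "\<And>k. lam k > 0"
    and "filterlim lam at_top sequentially"
    and "1 \<le> p" and "p < q"
  shows "ell_lambda_F p lam \<subset> ell_lambda_F q lam"
proof -
  let ?y = "\<lambda>n. real (Suc n) powr (- 1 / p)"
  obtain x where x: "?y = E lam x"
    using surjD[OF surj_E[OF assms(1,2)]] by blast
  \<comment> \<open>The exponent is critical: the p-th powers form the harmonic series, while the
    q-th powers decay with exponent \<open>- q / p < - 1\<close>.\<close>
  have "?y \<in> ell q" "?y \<notin> ell p"
    using assms(4,5) unfolding powr_mem_ell_iff by (simp_all add: field_simps)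
  then have "x \<in> ell_lambda_F q lam" "x \<notin> ell_lambda_F p lam"
    unfolding x by (simp_all add: ell_lambda_F_def)
  moreover have "ell_lambda_F p lam \<subseteq> ell_lambda_F q lam"
    using ell_mono[of p q] assms(4,5) by (auto simp: ell_lambda_F_def)
  ultimately show ?thesis by blast
qed

end
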